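(* Let $\mathcal{A} = (a_{i_1\cdots i_m})$ be a real symmetric tensor of order $m$ and dimension $n$. Then $\mathcal{A}$ is strictly semi-positive if and only if it is strictly copositive.
   Context: $m,n$ are positive integers and $I_n = \{1,2,\dots,n\}$. A real tensor of order $m$ and dimension $n$ is a multi-array $\mathcal{A} = (a_{i_1\cdots i_m})$ of real numbers with $i_j \in I_n$ for $j = 1,\dots,m$. It is symmetric if its entries $a_{i_1\cdots i_m}$ are invariant under any permutation of their indices. For $\mathbf{x} \in \mathbb{R}^n$, $\mathcal{A}\mathbf{x}^{m-1} \in \mathbb{R}^n$ is the vector with components $(\mathcal{A}\mathbf{x}^{m-1})_i = \sum_{i_2,\dots,i_m=1}^n a_{i i_2\cdots i_m} x_{i_2}\cdots x_{i_m}$, $i \in I_n$, and $\mathcal{A}\mathbf{x}^m = \mathbf{x}^\top(\mathcal{A}\mathbf{x}^{m-1}) = \sum_{i_1,\dots,i_m=1}^n a_{i_1\cdots i_m}x_{i_1}\cdots x_{i_m}$. $\mathbf{x} \geq \mathbf{0}$ means $x_i \geq 0$ for all $i \in I_n$, and $\mathbb{R}^n_+ = \{\mathbf{x} \in \mathbb{R}^n : \mathbf{x} \geq \mathbf{0}\}$. $\mathcal{A}$ is strictly semi-positive iff for each $\mathbf{x} \in \mathbb{R}^n$ with $\mathbf{x} \geq \mathbf{0}$ and $\mathbf{x} \neq \mathbf{0}$ there exists $k \in I_n$ such that $x_k > 0$ and $(\mathcal{A}\mathbf{x}^{m-1})_k > 0$. $\mathcal{A}$ is strictly copositive iff $\mathcal{A}\mathbf{x}^m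 > 0$ for all $\mathbf{x} \in \mathbb{R}^n_+ \setminus \{\mathbf{0}\}$. *)

theory Defs
  imports "HOL-Analysis.Analysis" "HOL-Combinatorics.Permutations"
begin

text \<open>
  The index set is a finite type \<open>'n\<close>, so the dimension is \<open>n = CARD('n) \<ge> 1\<close>.
  A tensor of order \<open>m\<close> is given by its entries \<open>A [i\<^sub>1, \<dots>, i\<^sub>m]\<close>;
  the values of \<open>A\<close> on lists of any other length are irrelevant: no definition
  below refers to them when \<open>m \<ge> 1\<close>.
\<close>

type_synonym 'n tensor = "'n list \<Rightarrow> real"

definition symmetric_tensor :: "nat \<Rightarrow> 'n::finite tensor \<Rightarrow> bool" where
  "symmetric_tensor m A \<longleftrightarrow>
    (\<forall>\<sigma> js. \<sigma> permutes {..<m} \<and> length js = m \<longrightarrow> A (permute_list \<sigma> js) = A js)"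

text \<open>The vector \<open>A x\<^sup>m\<^sup>-\<^sup>1\<close>; \<open>js\<close> ranges over \<open>(i\<^sub>2, \<dots>, i\<^sub>m)\<close>.\<close>

definition tensor_vec :: "nat \<Rightarrow> 'n::finite tensor \<Rightarrow> real ^ 'n \<Rightarrow> real ^ 'n" where
  "tensor_vec m A x =
    (\<chi> i. \<Sum>js\<in>{js. length js = m - 1}. A (i # js) * (\<Prod>j\<leftarrow>js. x $ j))"

text \<open>The scalar \<open>A x\<^sup>m\<close>.\<close>

definition tensor_form :: "nat \<Rightarrow> 'n::finite tensor \<Rightarrow> real ^ 'n \<Rightarrow> real" where
  "tensor_form m A x = x \<bullet> tensor_vec m A x"

lemma tensor_form_eq_sum:
  fixes A :: "'n::finite tensor"
  assumes "m \<ge> 1"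
  shows "tensor_form m A x = (\<Sum>js\<in>{js. length js = m}. A js * (\<Prod>j\<leftarrow>js. x $ j))"
proof -
  let ?L = "{js :: 'n list. length js = m - 1}"
  have "tensor_form m A x = (\<Sum>i\<in>UNIV. \<Sum>js\<in>?L. A (i # js) * (\<Prod>j\<leftarrow>i # js. x $ j))"
    by (simp add: tensor_form_def tensor_vec_def inner_vec_def sum_distrib_left mult_ac)
  also have "\<dots> = (\<Sum>(i, js)\<in>UNIV \<times> ?L. A (i # js) * (\<Prod>j\<leftarrow>i # js. x $ j))"
    by (rule sum.cartesian_product)
  also have "\<dots> = (\<Sum>js\<in>{js. length js = m}. A js * (\<Prod>j\<leftarrow>js. x $ j))"
    using assms
    by (intro sum.reindex_bij_witness[of _ "\<lambda>js. (hd js, tl js)" "\<lambda>(i, js). i # js"])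
       (auto intro!: hd_Cons_tl)
  finally show ?thesis .
qed

text \<open>The order on \<^typ>\<open>real ^ 'n\<close> is the componentwise one.\<close>

definition strictly_semi_positive :: "nat \<Rightarrow> 'n::finite tensor \<Rightarrow> bool" where
  "strictly_semi_positive m A \<longleftrightarrow>
    (\<forall>x :: real ^ 'n. x \<ge> 0 \<and> x \<noteq> 0 \<longrightarrow> (\<exists>k. x $ k > 0 \<and> tensor_vec m A x $ k > 0))"

definition strictly_copositive :: "nat \<Rightarrow> 'n::finite tensor \<Rightarrow> bool" where
  "strictly_copositive m A \<longleftrightarrow>
    (\<forall>x :: real ^ 'n. x \<ge> 0 \<and> x \<noteq> 0 \<longrightarrow> tensor_form m A x > 0)"

end

theory Submission imports Defs begin

text \<open>
  If \<open>A x\<^sup>m > 0\<close>, then one of the terms \<open>x\<^sub>k (A x\<^sup>m\<^sup>-\<^sup>1)\<^sub>k\<close> that sum up to it is positive, and for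
  \<open>x \<ge> 0\<close> both of its factors then are. So strict copositivity implies strict semi-positivity.

  The converse is a first-order optimality argument. By homogeneity, failure of strict
  copositivity means that \<open>A x\<^sup>m\<close> takes a value \<open>\<le> 0\<close> on the standard simplex, so by compactness
  its minimum there, attained at some \<open>y\<close>, satisfies \<open>A y\<^sup>m \<le> 0\<close>. Symmetry enters through
  the gradient: that of \<open>A x\<^sup>m\<close> is \<open>m A x\<^sup>m\<^sup>-\<^sup>1\<close> (\<open>tensor_eval_has_derivative\<close>). If \<open>y\<^sub>k > 0\<close>, one
  can move from \<open>y\<close> a little away from the vertex \<open>e\<^sub>k\<close> and stay inside the simplex; as the
  value cannot decrease, \<open>(A y\<^sup>m\<^sup>-\<^sup>1)\<^sub>k \<le> A y\<^sup>m \<le> 0\<close> (\<open>minimizer_tensor_vec_le\<close>). This holds for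
  every \<open>k\<close> in the support of \<open>y\<close>, which contradicts strict semi-positivity at \<open>y\<close>.
\<close>

text \<open>
  The form \<open>A x\<^sup>m\<close> as a sum over all indices. Unlike \<^const>\<open>tensor_form\<close>, it is also meaningful
  for \<open>m = 0\<close>, which makes induction on the order possible.
\<close>

definition tensor_eval :: "nat \<Rightarrow> 'n::finite tensor \<Rightarrow> real ^ 'n \<Rightarrow> real" where
  "tensor_eval m A x = (\<Sum>js\<in>{js. length js = m}. A js * (\<Prod>j\<leftarrow>js. x $ j))"

definition tensor_slice :: "'n tensor \<Rightarrow> 'n \<Rightarrow> 'n tensor" where
  "tensor_slice A i = (\<lambda>js. A (i # js))"

lemma tensor_form_eq_eval: "m \<ge> 1 \<Longrightarrow> tensor_form m A x = tensor_eval m A x"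
  by (simp add: tensor_form_eq_sum tensor_eval_def)

lemma tensor_vec_eq_eval: "tensor_vec m A x $ i = tensor_eval (m - 1) (tensor_slice A i) x"
  by (simp add: tensor_vec_def tensor_eval_def tensor_slice_def)

lemma tensor_eval_0: "tensor_eval 0 A x = A []"
  by (simp add: tensor_eval_def)

lemma tensor_eval_Suc:
  "tensor_eval (Suc m) A x = (\<Sum>i\<in>UNIV. x $ i * tensor_eval m (tensor_slice A i) x)"
proof -
  have "tensor_eval (Suc m) A x = tensor_form (Suc m) A x"
    by (simp add: tensor_form_eq_eval)
  then show ?thesis
    by (simp add: tensor_form_def inner_vec_def tensor_vec_eq_eval)
qed

lemma tensor_eval_scaleR: "tensor_eval m A (c *\<^sub>R x) = c ^ m * tensor_eval m A x"
  by (induction m arbitrary: A)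
     (simp_all add: tensor_eval_0 tensor_eval_Suc sum_distrib_left mult_ac)

text \<open>
  Invariance in terms of multisets passes to slices at once, since no permutation of positions
  has to be extended from the tail of the index to the whole index.
\<close>

lemma symmetric_tensor_iff_mset:
  fixes A :: "'n::finite tensor"
  shows "symmetric_tensor m A \<longleftrightarrow> (\<forall>ks js. length js = m \<and> mset ks = mset js \<longrightarrow> A ks = A js)"
proof
  assume sym: "symmetric_tensor m A"
  show "\<forall>ks js. length js = m \<and> mset ks = mset js \<longrightarrow> A ks = A js"
  proof (intro allI impI)
    fix ks js :: "'n list" assume "length js = m \<and> mset ks = mset js"
    moreover from this obtain \<sigma> where "\<sigma> permutes {..<length js}" "permute_list \<sigma> js = ks"
      using mset_eq_permutation by metis
    ultimately show "A ks = A js"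
      using sym unfolding symmetric_tensor_def by blast
  qed
next
  assume "\<forall>ks js. length js = m \<and> mset ks = mset js \<longrightarrow> A ks = A js"
  then show "symmetric_tensor m A"
    by (auto simp: symmetric_tensor_def)
qed

lemma symmetric_tensor_slice:
  assumes "symmetric_tensor (Suc m) A"
  shows "symmetric_tensor m (tensor_slice A i)"
  using assms by (simp add: symmetric_tensor_iff_mset tensor_slice_def)

lemma tensor_eval_slice_commute:
  assumes "symmetric_tensor (Suc (Suc m)) A"
  shows "tensor_eval m (tensor_slice (tensor_slice A i) j) x =
         tensor_eval m (tensor_slice (tensor_slice A j) i) x"
  unfolding tensor_eval_def tensor_slice_def
proof (rule sum.cong[OF refl])
  fix js :: "'a list" assume "js \<in> {js. length js = m}"
  then have "A (i # j # js) = A (j # i # js)"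
    using assms unfolding symmetric_tensor_iff_mset by (simp add: add_mset_commute)
  then show "A (i # j # js) * (\<Prod>j\<leftarrow>js. x $ j) = A (j # i # js) * (\<Prod>j\<leftarrow>js. x $ j)"
    by simp
qed

text \<open>
  Induction on the order, by the product rule for \<open>A x\<^sup>m\<^sup>+\<^sup>1 = \<Sum>\<^sub>i x\<^sub>i (A\<^sub>i x\<^sup>m)\<close>, where \<open>A\<^sub>i\<close> is the
  \<open>i\<close>-th slice. Differentiating the factors \<open>x\<^sub>i\<close> gives \<open>\<Sum>\<^sub>i v\<^sub>i (A\<^sub>i x\<^sup>m)\<close>; differentiating the
  forms gives \<open>m \<Sum>\<^sub>i \<Sum>\<^sub>j x\<^sub>i v\<^sub>j (A\<^sub>i\<^sub>j x\<^sup>m\<^sup>-\<^sup>1)\<close>, and because \<open>A\<^sub>i\<^sub>j = A\<^sub>j\<^sub>i\<close> the sum over \<open>i\<close> can be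
  carried out first, which yields \<open>m\<close> more copies of the first part.
\<close>

lemma tensor_eval_has_derivative:
  fixes A :: "'n::finite tensor"
  assumes "symmetric_tensor m A"
  shows "(tensor_eval m A has_derivative (\<lambda>v. real m * (v \<bullet> tensor_vec m A x))) (at x)"
  using assms
proof (induction m arbitrary: A)
  case 0
  have "tensor_eval 0 A = (\<lambda>x. A [])"
    by (simp add: fun_eq_iff tensor_eval_0)
  then show ?case by simp
next
  case (Suc m)
  have "((\<lambda>x. \<Sum>i\<in>UNIV. x $ i * tensor_eval m (tensor_slice A i) x) has_derivative
          (\<lambda>v. \<Sum>i\<in>UNIV. x $ i * (real m * (v \<bullet> tensor_vec m (tensor_slice A i) x)) +
                         v $ i * tensor_eval m (tensor_slice A i) x)) (at x)"
    by (intro has_derivative_sum has_derivative_mult Suc.IH symmetric_tensor_slice Suc.prems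
          bounded_linear_imp_has_derivative bounded_linear_vec_nth)
  moreover have "(\<Sum>i\<in>UNIV. x $ i * (real m * (v \<bullet> tensor_vec m (tensor_slice A i) x)) +
                         v $ i * tensor_eval m (tensor_slice A i) x) =
                 real (Suc m) * (v \<bullet> tensor_vec (Suc m) A x)" for v
  proof -
    have *: "real m * (\<Sum>i\<in>UNIV. x $ i * (v \<bullet> tensor_vec m (tensor_slice A i) x)) =
          real m * (v \<bullet> tensor_vec (Suc m) A x)"
    proof (cases m)
      case 0
      then show ?thesis by simp
    next
      case (Suc k)
      have "(\<Sum>i\<in>UNIV. x $ i * (v \<bullet> tensor_vec m (tensor_slice A i) x)) =
            (\<Sum>i\<in>UNIV. \<Sum>j\<in>UNIV. v $ j *
               (x $ i * tensor_eval k (tensor_slice (tensor_slice A i) j) x))"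
        by (simp add: Suc inner_vec_def tensor_vec_eq_eval sum_distrib_left mult_ac)
      also have "\<dots> = (\<Sum>j\<in>UNIV. \<Sum>i\<in>UNIV. v $ j *
               (x $ i * tensor_eval k (tensor_slice (tensor_slice A i) j) x))"
        by (rule sum.swap)
      also have "\<dots> = (\<Sum>j\<in>UNIV. \<Sum>i\<in>UNIV. v $ j *
               (x $ i * tensor_eval k (tensor_slice (tensor_slice A j) i) x))"
        using Suc.prems Suc by (intro sum.cong refl) (metis tensor_eval_slice_commute)
      also have "\<dots> = v \<bullet> tensor_vec (Suc m) A x"
        by (simp add: Suc inner_vec_def tensor_vec_eq_eval tensor_eval_Suc sum_distrib_left)
      finally show ?thesis by simp
    qed
    have "(\<Sum>i\<in>UNIV. x $ i * (real m * (v \<bullet> tensor_vec m (tensor_slice A i) x)) +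
                         v $ i * tensor_eval m (tensor_slice A i) x) =
          real m * (\<Sum>i\<in>UNIV. x $ i * (v \<bullet> tensor_vec m (tensor_slice A i) x)) +
          v \<bullet> tensor_vec (Suc m) A x"
      by (simp add: sum.distrib sum_distrib_left inner_vec_def[of v "tensor_vec (Suc m) A x"]
            tensor_vec_eq_eval mult_ac)
    also have "\<dots> = real (Suc m) * (v \<bullet> tensor_vec (Suc m) A x)"
      by (simp add: * algebra_simps)
    finally show ?thesis .
  qed
  moreover have "tensor_eval (Suc m) A =
      (\<lambda>x. \<Sum>i\<in>UNIV. x $ i * tensor_eval m (tensor_slice A i) x)"
    by (simp add: fun_eq_iff tensor_eval_Suc)
  ultimately show ?case by simp
qed

definition standard_simplex :: "(real ^ 'n::finite) set" where
  "standard_simplex = {x. x \<ge> 0 \<and> (\<Sum>i\<in>UNIV. x $ i) = 1}"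

lemma compact_standard_simplex: "compact (standard_simplex :: (real ^ 'n::finite) set)"
proof -
  have "x $ i \<le> 1" if "x \<ge> 0" "(\<Sum>i\<in>UNIV. x $ i) = 1" for x :: "real ^ 'n" and i
    using that member_le_sum[of i UNIV "\<lambda>i. x $ i"] by (auto simp: less_eq_vec_def)
  then have "standard_simplex = cbox 0 1 \<inter> {x :: real ^ 'n. (\<Sum>i\<in>UNIV. x $ i) = 1}"
    by (auto simp: standard_simplex_def mem_box_cart less_eq_vec_def)
  moreover have "closed {x :: real ^ 'n. (\<Sum>i\<in>UNIV. x $ i) = 1}"
    by (intro closed_Collect_eq continuous_intros)
  ultimately show ?thesis
    by (metis compact_Int_closed compact_cbox)
qed

text \<open>
  The first-order condition along \<open>v = y - e\<^sub>k\<close>. The point \<open>y + t v\<close> lies in the simplex for small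
  \<open>t > 0\<close> exactly because \<open>y\<^sub>k > 0\<close>, and the slope at \<open>t = 0\<close> is
  \<open>m (A y\<^sup>m - (A y\<^sup>m\<^sup>-\<^sup>1)\<^sub>k)\<close>.
\<close>

lemma minimizer_tensor_vec_le:
  fixes A :: "'n::finite tensor"
  assumes m: "m \<ge> 1" and sym: "symmetric_tensor m A"
    and y: "y \<in> standard_simplex"
    and min: "\<And>z. z \<in> standard_simplex \<Longrightarrow> tensor_eval m A y \<le> tensor_eval m A z"
    and k: "y $ k > 0"
  shows "tensor_vec m A y $ k \<le> tensor_eval m A y"
proof (rule ccontr)
  assume contra: "\<not> ?thesis"
  define v where "v = y - axis k 1"
  define h where "h = (\<lambda>t. tensor_eval m A (y + t *\<^sub>R v))"
  define s where "s = real m * (v \<bullet> tensor_vec m A y)"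
  have "v \<bullet> tensor_vec m A y = tensor_eval m A y - tensor_vec m A y $ k"
    using m by (simp add: v_def inner_diff_left inner_axis' tensor_form_eq_eval[symmetric]
        tensor_form_def)
  then have "s < 0"
    using contra m by (simp add: s_def mult_pos_neg)
  have "((\<lambda>t. y + t *\<^sub>R v) has_derivative (\<lambda>t. t *\<^sub>R v)) (at 0)"
    by (auto intro!: derivative_eq_intros)
  moreover have "(tensor_eval m A has_derivative (\<lambda>v. real m * (v \<bullet> tensor_vec m A y)))
      (at (y + 0 *\<^sub>R v))"
    using tensor_eval_has_derivative[OF sym, of y] by simp
  ultimately have "(h has_derivative (\<lambda>t. real m * (t *\<^sub>R v \<bullet> tensor_vec m A y))) (at 0)"
    unfolding h_def by (rule has_derivative_compose)
  then have "(h has_real_derivative s) (at 0)"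
    by (rule has_derivative_imp_has_field_derivative) (simp add: s_def)
  then obtain d where d: "d > 0" "\<And>t. 0 < t \<Longrightarrow> t < d \<Longrightarrow> h t < h 0"
    using DERIV_neg_dec_right[of h s 0] \<open>s < 0\<close> by auto
  define t where "t = min (d / 2) (y $ k)"
  have t: "0 < t" "t < d" "t \<le> y $ k"
    using d(1) k by (auto simp: t_def)
  have y': "\<And>i. 0 \<le> y $ i" "(\<Sum>i\<in>UNIV. y $ i) = 1"
    using y by (auto simp: standard_simplex_def less_eq_vec_def)
  have "0 \<le> (y + t *\<^sub>R v) $ i" for i
  proof (cases "i = k")
    case True
    \<comment> \<open>The coordinate is \<open>y\<^sub>k + t y\<^sub>k - t\<close>, and \<open>t \<le> y\<^sub>k\<close>.\<close>
    have "0 \<le> t * y $ k"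
      using t k by simp
    with True show ?thesis
      using t(3) by (simp add: v_def axis_def right_diff_distrib)
  next
    case False
    then show ?thesis
      using t y' by (simp add: v_def axis_def)
  qed
  moreover have "(\<Sum>i\<in>UNIV. (y + t *\<^sub>R v) $ i) = 1"
  proof -
    have "(\<Sum>i\<in>UNIV. v $ i) = 0"
      using y' by (simp add: v_def sum_subtractf axis_def)
    then show ?thesis
      using y' by (simp add: sum.distrib sum_distrib_left[symmetric])
  qed
  ultimately have "y + t *\<^sub>R v \<in> standard_simplex"
    by (simp add: standard_simplex_def less_eq_vec_def)
  then have "h 0 \<le> h t"
    using min by (simp add: h_def)
  with d(2) t show False by fastforce
qed

theorem theorem3p4:
  fixes A :: "'n::finite tensor" and m :: nat
  assumes "m \<ge> 1" and "symmetric_tensor m A"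
  shows "strictly_semi_positive m A \<longleftrightarrow> strictly_copositive m A"
proof
  assume ssp: "strictly_semi_positive m A"
  show "strictly_copositive m A"
    unfolding strictly_copositive_def
  proof (intro allI impI)
    fix x :: "real ^ 'n"
    assume x: "x \<ge> 0 \<and> x \<noteq> 0"
    show "tensor_form m A x > 0"
    proof (rule ccontr)
      assume "\<not> tensor_form m A x > 0"
      then have nonpos: "tensor_eval m A x \<le> 0"
        using assms by (simp add: tensor_form_eq_eval)
      define c where "c = (\<Sum>i\<in>UNIV. x $ i)"
      have "c \<noteq> 0"
        using x sum_nonneg_eq_0_iff[of UNIV "\<lambda>i. x $ i"]
        by (auto simp: c_def less_eq_vec_def vec_eq_iff)
      moreover have "c \<ge> 0"
        using x by (auto simp: c_def less_eq_vec_def intro: sum_nonneg)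
      ultimately have "c > 0" by simp
      define z where "z = (1 / c) *\<^sub>R x"
      have z: "z \<in> standard_simplex"
        using x \<open>c > 0\<close>
        by (simp add: z_def standard_simplex_def less_eq_vec_def sum_divide_distrib[symmetric]
            c_def[symmetric])
      have "continuous_on standard_simplex (tensor_eval m A)"
        using tensor_eval_has_derivative[OF assms(2)] has_derivative_continuous
        by (intro continuous_at_imp_continuous_on) blast
      then obtain y where y: "y \<in> standard_simplex"
        and min: "\<And>z. z \<in> standard_simplex \<Longrightarrow> tensor_eval m A y \<le> tensor_eval m A z"
        using continuous_attains_inf[OF compact_standard_simplex] z by blast
      have "tensor_eval m A z \<le> 0"
        using nonpos \<open>c > 0\<close> by (simp add: z_def tensor_eval_scaleR mult_nonneg_nonpos divide_nonpos_pos)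
      then have "tensor_eval m A y \<le> 0"
        using min[OF z] by simp
      then have "tensor_vec m A y $ k \<le> 0" if "y $ k > 0" for k
        using minimizer_tensor_vec_le[OF assms y min that] by simp
      moreover have "y \<ge> 0" "y \<noteq> 0"
        using y by (auto simp: standard_simplex_def)
      ultimately show False
        using ssp unfolding strictly_semi_positive_def by (meson not_le)
    qed
  qed
next
  assume scp: "strictly_copositive m A"
  show "strictly_semi_positive m A"
    unfolding strictly_semi_positive_def
  proof (intro allI impI)
    fix x :: "real ^ 'n"
    assume x: "x \<ge> 0 \<and> x \<noteq> 0"
    then have "0 < (\<Sum>k\<in>UNIV. x $ k * tensor_vec m A x $ k)"
      using scp by (simp add: strictly_copositive_def tensor_form_def inner_vec_def)
    then obtain k where "0 < x $ k * tensor_vec m A x $ k"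
      by (meson sum_nonpos not_le)
    moreover have "x $ k \<ge> 0"
      using x by (simp add: less_eq_vec_def)
    ultimately show "\<exists>k. x $ k > 0 \<and> tensor_vec m A x $ k > 0"
      by (auto simp: zero_less_mult_iff)
  qed
qed

end
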